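(* Let $\theta>0$, let $A_i,\alpha_i>0$, $a_i\ge0$ for $i=1,\dots,p$ and $B_j,\beta_j>0$, $b_j\ge0$ for $j=1,\dots,s$, and for $x>0$ let $$V(x)=\theta^{-x}\frac{\prod_{i=1}^p\Gamma(A_ix+a_i)^{\alpha_i}}{\prod_{j=1}^s\Gamma(B_jx+b_j)^{\beta_j}}.$$ Let $(h_{ji})$, $1\le j\le s$, $1\le i\le p$, be a row stochastic matrix such that $$\alpha_iA_i\ge\sum_{j=1}^s\beta_jB_jh_{ji}\quad\text{for } i=1,\dots,p,\qquad b_j\ge B_j\sum_{i=1}^p\frac{a_i}{A_i}h_{ji}+1\quad\text{for } j=1,\dots,s.$$ Then $(\log V)''$ is completely monotonic. If, moreover, $$\sum_{i=1}^p\alpha_iA_i=\sum_{j=1}^s\beta_jB_j\quad\text{and}\quad \prod_{i=1}^pA_i^{\alpha_iA_i}\prod_{j=1}^sB_j^{-\beta_jB_j}\le\theta,$$ then $V$ is logarithmically completely monotonic.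
   Context: $\Gamma$ is Euler's gamma function. A real $s\times p$ matrix $(h_{ji})$ is row stochastic if $h_{ji}\ge0$ for all $j,i$ and $\sum_{i=1}^ph_{ji}=1$ for each $j$. A function $f:(0,\infty)\to\mathbb R$ is completely monotonic if it is infinitely differentiable, $f\ge0$, and $(-1)^nf^{(n)}(x)\ge0$ for all $n\ge1$, $x>0$. A positive function $f$ on $(0,\infty)$ is logarithmically completely monotonic if $-(\log f)'$ is completely monotonic. *)

theory Defs
  imports "HOL-Analysis.Analysis"
begin

(* The analytic predicates below only concern the half-line (0, oo). Functions are total on real, but
   deriv at a point x > 0 depends only on the values near x, so values at x <= 0 are irrelevant. *)

definition infinitely_differentiable_pos :: "(real \<Rightarrow> real) \<Rightarrow> bool" where
  "infinitely_differentiable_pos f \<longleftrightarrow> (\<forall>n. \<forall>x>0. (deriv ^^ n) f differentiable (at x))"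

definition completely_monotonic :: "(real \<Rightarrow> real) \<Rightarrow> bool" where
  "completely_monotonic f \<longleftrightarrow>
     infinitely_differentiable_pos f \<and> (\<forall>x>0. f x \<ge> 0) \<and>
     (\<forall>n\<ge>1. \<forall>x>0. (- 1) ^ n * (deriv ^^ n) f x \<ge> 0)"

(* The differentiability clause says that (log f)' exists: deriv is a total operator whose value
   at a point of non-differentiability is unspecified. *)
definition log_completely_monotonic :: "(real \<Rightarrow> real) \<Rightarrow> bool" where
  "log_completely_monotonic f \<longleftrightarrow>
     (\<forall>x>0. f x > 0) \<and>
     (\<forall>x>0. (\<lambda>y. ln (f y)) differentiable (at x)) \<and>
     completely_monotonic (\<lambda>x. - deriv (\<lambda>y. ln (f y)) x)"

(* Twice differentiable on (0, oo), so that deriv (deriv f) there is the genuine f''. *)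
definition twice_differentiable_pos :: "(real \<Rightarrow> real) \<Rightarrow> bool" where
  "twice_differentiable_pos f \<longleftrightarrow>
     (\<forall>x>0. f differentiable (at x) \<and> deriv f differentiable (at x))"

(* Rows are indexed by j = 1..s and columns by i = 1..p. *)
definition row_stochastic :: "nat \<Rightarrow> nat \<Rightarrow> (nat \<Rightarrow> nat \<Rightarrow> real) \<Rightarrow> bool" where
  "row_stochastic s p h \<longleftrightarrow>
     (\<forall>j\<in>{1..s}. \<forall>i\<in>{1..p}. h j i \<ge> 0) \<and> (\<forall>j\<in>{1..s}. (\<Sum>i=1..p. h j i) = 1)"

end

theory Submission
  imports Defs
begin

text \<open>
  Everything rests on comparing $\psi = (\log\Gamma)'$ with the logarithm, derivative by derivative.
  Write $L_n(z) = (-1)^{n+1}\log^{(n)}(z)$ for $n \ge 0$. Comparing the series of $\psi^{(n)}$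
  termwise with a telescoping series of $L_n$ gives, for $z > 0$,
  \[ (-1)^{n+1}\psi^{(n)}(z+1) \le L_n(z) \le (-1)^{n+1}\psi^{(n)}(z) \]
  (lemma \<open>alt_Polygamma_sandwich\<close>).

  In the signed derivative $(-1)^{n+1}(\log V)^{(n+1)}$, the upper bound for $L_n$ handles the numerator
  terms at $z = A_i(x + a_i/A_i)$, and the lower bound handles the denominator terms at
  $z = B_jx + b_j - 1 \ge B_j(x + \sum_i h_{ji}a_i/A_i)$. Since $L_n$ is decreasing and convex, Jensen's
  inequality with the weights $h_{ji}$ moves the denominator terms to the same points $x + a_i/A_i$.
  The dilations cost nothing, as $A^nL_n(Ay) = L_n(y)$ for $n \ge 1$, so what is left in that case is
  \[ (-1)^{n+1}(\log V)^{(n+1)}(x) \ge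
     \sum_i \Bigl(\alpha_iA_i - \sum_j \beta_jB_jh_{ji}\Bigr) L_n(x + a_i/A_i), \]
  which is nonnegative by the hypothesis on the column sums, because $L_n > 0$ for $n \ge 1$. So
  $(\log V)''$ is completely monotonic.

  For $n = 0$ the function $L_0 = -\log$ has no sign, and dilation adds constants. Those
  constants sum up, together with $\log\theta$, to
  $\log\theta - \sum_i\alpha_iA_i\log A_i + \sum_j\beta_jB_j\log B_j$, which the condition on $\theta$
  makes nonnegative. When $\sum_i\alpha_iA_i = \sum_j\beta_jB_j$, the nonnegative coefficients of the
  $L_0(x + a_i/A_i)$ add up to $0$, so each of them vanishes. Hence $-(\log V)' \ge 0$ follows from the
  same estimate pointwise (lemma \<open>alt_Polygamma_balance\<close> treats all $n$ at once).
\<close>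

section \<open>Signed derivatives of the logarithm\<close>

text \<open>
  This is $(-1)^{n+1}$ times the $n$th derivative of the logarithm. The sign is chosen so that the
  function is decreasing and convex for every $n$, including $n = 0$.
\<close>

definition alt_ln_deriv :: "nat \<Rightarrow> real \<Rightarrow> real" where
  "alt_ln_deriv n z = (if n = 0 then - ln z else fact (n - 1) / z ^ n)"

lemma has_field_derivative_alt_ln_deriv:
  assumes "z > 0"
  shows "(alt_ln_deriv n has_real_derivative - (fact n / z ^ Suc n)) (at z)"
proof (cases n)
  case 0
  have "((\<lambda>z. - ln z) has_real_derivative - (fact n / z ^ Suc n)) (at z)"
    using assms 0 by (auto intro!: derivative_eq_intros simp: divide_inverse)
  then show ?thesis
    using 0 by (simp add: alt_ln_deriv_def[abs_def])
next
  case (Suc m)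
  have "((\<lambda>z. z ^ Suc m) has_real_derivative (1 + real m) * (1 * z ^ m)) (at z)"
    by (intro DERIV_power_Suc DERIV_ident)
  from DERIV_cmult[OF DERIV_inverse'[OF this], of "fact m"]
  have "((\<lambda>z. fact m / z ^ Suc m) has_real_derivative
      fact m * - (inverse (z ^ Suc m) * ((1 + real m) * (1 * z ^ m)) * inverse (z ^ Suc m))) (at z)"
    using assms by (simp add: divide_inverse)
  also have "fact m * - (inverse (z ^ Suc m) * ((1 + real m) * (1 * z ^ m)) * inverse (z ^ Suc m))
      = - (fact n / z ^ Suc n)"
    using assms Suc by (simp add: field_simps)
  finally have "((\<lambda>z. fact m / z ^ Suc m) has_real_derivative - (fact n / z ^ Suc n)) (at z)" .
  then show ?thesis
    using Suc by (simp add: alt_ln_deriv_def[abs_def])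
qed

lemma alt_ln_deriv_antimono:
  assumes "0 < x" "x \<le> y"
  shows "alt_ln_deriv n y \<le> alt_ln_deriv n x"
  using assms by (auto simp: alt_ln_deriv_def intro!: divide_left_mono power_mono)

lemma alt_ln_deriv_nonneg:
  assumes "0 < z" "n \<noteq> 0"
  shows "alt_ln_deriv n z \<ge> 0"
  using assms by (simp add: alt_ln_deriv_def)

lemma alt_ln_deriv_scale:
  assumes "0 < c" "0 < z"
  shows "c ^ n * alt_ln_deriv n (c * z) = alt_ln_deriv n z - (if n = 0 then ln c else 0)"
  using assms by (simp add: alt_ln_deriv_def ln_mult power_mult_distrib)

lemma convex_on_alt_ln_deriv: "convex_on {0<..} (alt_ln_deriv n)"
proof (rule convex_on_realI)
  show "(alt_ln_deriv n has_real_derivative - (fact n / z ^ Suc n)) (at z)"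
    if "z \<in> {0<..}" for z
    using that by (intro has_field_derivative_alt_ln_deriv) simp
  show "- (fact n / x ^ Suc n) \<le> - (fact n / y ^ Suc n)"
    if "x \<in> {0<..}" "y \<in> {0<..}" "x \<le> y" for x y :: real
    using that by (auto intro!: divide_left_mono power_mono mult_mono mult_pos_pos)
qed auto

text \<open>
  By the mean value theorem the difference equals $n!/t^{n+1}$ for some $t$ strictly between $y$ and $y+1$.
\<close>

lemma alt_ln_deriv_step:
  assumes "0 < y"
  shows "fact n / (y + 1) ^ Suc n \<le> alt_ln_deriv n y - alt_ln_deriv n (y + 1)"
    and "alt_ln_deriv n y - alt_ln_deriv n (y + 1) \<le> fact n / y ^ Suc n"
proof -
  obtain t where t: "y < t" "t < y + 1"
    and "alt_ln_deriv n (y + 1) - alt_ln_deriv n y = (y + 1 - y) * - (fact n / t ^ Suc n)"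
    using MVT2[of y "y + 1" "alt_ln_deriv n" "\<lambda>z. - (fact n / z ^ Suc n)"]
      has_field_derivative_alt_ln_deriv assms by force
  then have eq: "alt_ln_deriv n y - alt_ln_deriv n (y + 1) = fact n / t ^ Suc n"
    by simp
  show "fact n / (y + 1) ^ Suc n \<le> alt_ln_deriv n y - alt_ln_deriv n (y + 1)"
    unfolding eq using assms t
    by (intro divide_left_mono power_mono) auto
  show "alt_ln_deriv n y - alt_ln_deriv n (y + 1) \<le> fact n / y ^ Suc n"
    unfolding eq using assms t
    by (intro divide_left_mono power_mono) auto
qed

section \<open>Comparing polygamma functions with the logarithm\<close>

text \<open>
  One formula for all $n$: for $n \ge 1$ the series of $\psi^{(n)}$ converges and the second summand
  tends to $0$; for $n = 0$ the second summand is the term $-\log m$ that compensates the divergence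
  of $\sum 1/(z+k)$.
\<close>

lemma alt_Polygamma_LIMSEQ:
  fixes z :: real
  assumes "z > 0"
  shows "(\<lambda>m. (\<Sum>k<m. fact n / (z + real k) ^ Suc n) + alt_ln_deriv n (real m))
           \<longlonglongrightarrow> (- 1) ^ Suc n * Polygamma n z"
proof (cases n)
  case 0
  have "(\<lambda>m. - (ln (real m) - (\<Sum>k<m. inverse (z + real k)))) \<longlonglongrightarrow> - Digamma z"
    using Digamma_LIMSEQ[of z] assms by (intro tendsto_minus) auto
  then show ?thesis
    using 0 by (simp add: alt_ln_deriv_def inverse_eq_divide)
next
  case (Suc m)
  have "z \<noteq> 0" using assms by simp
  then have "(\<lambda>k. fact n * inverse ((z + real k) ^ Suc n)) sums
      (fact n * ((- 1) ^ Suc n * Polygamma n z / fact n))"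
    using Suc by (intro sums_mult Polygamma_LIMSEQ) auto
  also have "fact n * ((- 1) ^ Suc n * Polygamma n z / fact n) = (- 1) ^ Suc n * Polygamma n z"
    by simp
  finally have "(\<lambda>m. \<Sum>k<m. fact n / (z + real k) ^ Suc n)
      \<longlonglongrightarrow> (- 1) ^ Suc n * Polygamma n z"
    by (simp add: sums_def divide_inverse del: power_Suc)
  moreover have "(\<lambda>k. alt_ln_deriv n (real k)) \<longlonglongrightarrow> 0"
    unfolding alt_ln_deriv_def using Suc
    by (auto intro!: tendsto_divide_0[OF tendsto_const] filterlim_at_top_imp_at_infinity
          filterlim_pow_at_top filterlim_real_sequentially simp del: power_Suc)
  ultimately show ?thesis
    using tendsto_add by fastforce
qed

text \<open>
  The counterpart for the telescoped comparison series, corrected by the same term so that the two limits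
  can be compared directly.
\<close>

lemma alt_ln_deriv_shift_LIMSEQ:
  assumes "z > 0"
  shows "(\<lambda>m. alt_ln_deriv n z - alt_ln_deriv n (z + real m) + alt_ln_deriv n (real m))
           \<longlonglongrightarrow> alt_ln_deriv n z"
proof (cases n)
  case 0
  have "(\<lambda>m. ln (1 + z / real m)) \<longlonglongrightarrow> ln (1 + 0)"
    by (intro tendsto_intros tendsto_divide_0[OF tendsto_const]
          filterlim_at_top_imp_at_infinity filterlim_real_sequentially) simp
  then have "(\<lambda>m. - ln z + ln (1 + z / real m)) \<longlonglongrightarrow> - ln z + 0"
    by (intro tendsto_add tendsto_const) simp
  moreover have "\<forall>\<^sub>F m in sequentially.
      - ln z + ln (1 + z / real m) = - ln z + ln (z + real m) - ln (real m)"
    using eventually_gt_at_top[of 0]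
  proof eventually_elim
    case (elim m)
    have "1 + z / real m = (z + real m) / real m"
      using elim by (simp add: field_simps)
    then show ?case
      using elim assms by (simp add: ln_div)
  qed
  ultimately have "(\<lambda>m. - ln z + ln (z + real m) - ln (real m)) \<longlonglongrightarrow> - ln z + 0"
    by (rule Lim_transform_eventually)
  then show ?thesis
    using 0 by (simp add: alt_ln_deriv_def)
next
  case (Suc l)
  have "(\<lambda>m. alt_ln_deriv n (z + real m)) \<longlonglongrightarrow> 0" "(\<lambda>m. alt_ln_deriv n (real m)) \<longlonglongrightarrow> 0"
    unfolding alt_ln_deriv_def using Suc
    by (auto intro!: tendsto_divide_0[OF tendsto_const] filterlim_at_top_imp_at_infinity
          filterlim_pow_at_top filterlim_real_sequentially
          filterlim_tendsto_add_at_top[OF tendsto_const] simp del: power_Suc)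
  then have "(\<lambda>m. alt_ln_deriv n z - alt_ln_deriv n (z + real m) + alt_ln_deriv n (real m))
      \<longlonglongrightarrow> alt_ln_deriv n z - 0 + 0"
    by (intro tendsto_intros)
  then show ?thesis by simp
qed

text \<open>
  The unit steps of \<open>alt_ln_deriv n\<close> from \<open>z + k\<close> to \<open>z + k + 1\<close> lie between consecutive terms of
  the series of $\psi^{(n)}$ and telescope; summing and passing to the limit gives both bounds.
\<close>

lemma alt_Polygamma_sandwich:
  fixes z :: real
  assumes "z > 0"
  shows alt_ln_deriv_le_alt_Polygamma: "alt_ln_deriv n z \<le> (- 1) ^ Suc n * Polygamma n z"
    and alt_Polygamma_le_alt_ln_deriv: "(- 1) ^ Suc n * Polygamma n (z + 1) \<le> alt_ln_deriv n z"
proof -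
  have telescope: "(\<Sum>k<m. alt_ln_deriv n (z + real k) - alt_ln_deriv n (z + real k + 1))
      = alt_ln_deriv n z - alt_ln_deriv n (z + real m)" for m
    using sum_lessThan_telescope'[of "\<lambda>k. alt_ln_deriv n (z + real k)" m] by (simp add: add_ac)
  have upper: "(\<Sum>k<m. fact n / (z + 1 + real k) ^ Suc n)
      \<le> alt_ln_deriv n z - alt_ln_deriv n (z + real m)" for m
    unfolding telescope[symmetric] using assms
    by (intro sum_mono order_trans[OF _ alt_ln_deriv_step(1)]) (auto simp: add_ac)
  have lower: "alt_ln_deriv n z - alt_ln_deriv n (z + real m)
      \<le> (\<Sum>k<m. fact n / (z + real k) ^ Suc n)" for m
    unfolding telescope[symmetric] using assms
    by (intro sum_mono alt_ln_deriv_step(2)) auto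
  show "alt_ln_deriv n z \<le> (- 1) ^ Suc n * Polygamma n z"
    by (rule LIMSEQ_le[OF alt_ln_deriv_shift_LIMSEQ alt_Polygamma_LIMSEQ])
       (use assms lower in \<open>auto simp del: power_Suc\<close>)
  show "(- 1) ^ Suc n * Polygamma n (z + 1) \<le> alt_ln_deriv n z"
    by (rule LIMSEQ_le[OF alt_Polygamma_LIMSEQ alt_ln_deriv_shift_LIMSEQ])
       (use assms upper in \<open>auto simp del: power_Suc\<close>)
qed

section \<open>Transferring the estimate through the stochastic matrix\<close>

text \<open>
  Jensen's inequality with the rows of \<open>h\<close> as weights brings numerator and denominator to the common points
  $x + a_i/A_i$, where they can be compared coefficient by coefficient. On the right stands a signed
  derivative of $(\log V)'$ up to the contribution of $\theta$; the constant for $n = 0$ comes from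
  $\log(A_iy) = \log A_i + \log y$.
\<close>

lemma alt_Polygamma_balance:
  fixes A a \<alpha> :: "'i \<Rightarrow> real" and B b \<beta> :: "'j \<Rightarrow> real" and h :: "'j \<Rightarrow> 'i \<Rightarrow> real"
  assumes "finite I"
    and A: "\<And>i. i \<in> I \<Longrightarrow> A i > 0 \<and> \<alpha> i \<ge> 0 \<and> a i \<ge> 0"
    and B: "\<And>j. j \<in> J \<Longrightarrow> B j > 0 \<and> \<beta> j \<ge> 0"
    and h_nonneg: "\<And>i j. i \<in> I \<Longrightarrow> j \<in> J \<Longrightarrow> h j i \<ge> 0"
    and h_sum: "\<And>j. j \<in> J \<Longrightarrow> (\<Sum>i\<in>I. h j i) = 1"
    and rowsum: "\<And>j. j \<in> J \<Longrightarrow> b j \<ge> B j * (\<Sum>i\<in>I. a i / A i * h j i) + 1"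
    and x: "x > 0"
  shows "(\<Sum>i\<in>I. (\<alpha> i * A i - (\<Sum>j\<in>J. \<beta> j * B j * h j i)) * alt_ln_deriv n (x + a i / A i))
           - (if n = 0 then (\<Sum>i\<in>I. \<alpha> i * A i * ln (A i)) - (\<Sum>j\<in>J. \<beta> j * B j * ln (B j)) else 0)
         \<le> (- 1) ^ Suc n * ((\<Sum>i\<in>I. \<alpha> i * A i ^ Suc n * Polygamma n (A i * x + a i))
           - (\<Sum>j\<in>J. \<beta> j * B j ^ Suc n * Polygamma n (B j * x + b j)))"
proof -
  let ?L = "alt_ln_deriv n"
  let ?\<psi> = "\<lambda>z. (- 1) ^ Suc n * Polygamma n z :: real"
  let ?l = "\<lambda>c. if n = 0 then ln c else 0 :: real"
  have num: "\<alpha> i * A i * (?L (x + a i / A i) - ?l (A i)) \<le> \<alpha> i * A i ^ Suc n * ?\<psi> (A i * x + a i)"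
    if i: "i \<in> I" for i
  proof -
    have pos: "A i > 0" "x + a i / A i > 0" "A i * x + a i > 0"
      using A[OF i] x by (auto intro: add_pos_nonneg)
    have "?L (x + a i / A i) - ?l (A i) = A i ^ n * ?L (A i * (x + a i / A i))"
      using pos by (simp add: alt_ln_deriv_scale)
    also have "A i * (x + a i / A i) = A i * x + a i"
      using pos by (simp add: field_simps)
    finally have "?L (x + a i / A i) - ?l (A i) \<le> A i ^ n * ?\<psi> (A i * x + a i)"
      using mult_left_mono[OF alt_ln_deriv_le_alt_Polygamma[OF pos(3), of n], of "A i ^ n"] pos(1)
      by simp
    then have "\<alpha> i * A i * (?L (x + a i / A i) - ?l (A i))
        \<le> \<alpha> i * A i * (A i ^ n * ?\<psi> (A i * x + a i))"
      using A[OF i] by (intro mult_left_mono) auto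
    then show ?thesis by (simp add: mult_ac)
  qed
  have den: "\<beta> j * B j ^ Suc n * ?\<psi> (B j * x + b j)
      \<le> \<beta> j * B j * ((\<Sum>i\<in>I. h j i * ?L (x + a i / A i)) - ?l (B j))"
    if j: "j \<in> J" for j
  proof -
    define c where "c = (\<Sum>i\<in>I. h j i * (x + a i / A i))"
    \<comment> \<open>The row sums being 1, averaging the points \<open>x + a i / A i\<close> keeps \<open>x\<close> and averages the shifts.\<close>
    have c: "c = x + (\<Sum>i\<in>I. a i / A i * h j i)"
      using h_sum[OF j] by (simp add: c_def algebra_simps sum.distrib flip: sum_distrib_left)
    have "(\<Sum>i\<in>I. a i / A i * h j i) \<ge> 0"
      using A h_nonneg[OF _ j] by (intro sum_nonneg) (auto simp: less_imp_le)
    then have c_pos: "c > 0" using c x by simp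
    have Bj: "B j > 0" "\<beta> j \<ge> 0" using B[OF j] by auto
    have le: "B j * c \<le> B j * x + b j - 1"
      using rowsum[OF j] by (simp add: c algebra_simps)
    then have pos: "B j * x + b j - 1 > 0"
      using Bj c_pos by (meson less_le_trans mult_pos_pos)
    have "?\<psi> (B j * x + b j) \<le> ?L (B j * x + b j - 1)"
      using alt_Polygamma_le_alt_ln_deriv[OF pos, of n] by simp
    also have "\<dots> \<le> ?L (B j * c)"
      using le Bj c_pos by (intro alt_ln_deriv_antimono) auto
    finally have "B j ^ n * ?\<psi> (B j * x + b j) \<le> B j ^ n * ?L (B j * c)"
      using Bj by (intro mult_left_mono) auto
    also have "\<dots> = ?L c - ?l (B j)"
      using Bj c_pos by (simp add: alt_ln_deriv_scale)
    also have "?L c \<le> (\<Sum>i\<in>I. h j i * ?L (x + a i / A i))"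
    proof -
      have "I \<noteq> {}" using h_sum[OF j] by auto
      then show ?thesis
        using convex_on_sum[OF \<open>finite I\<close> _ convex_on_alt_ln_deriv[of n] h_sum[OF j],
            where y = "\<lambda>i. x + a i / A i"] h_nonneg[OF _ j] A x
        by (auto simp: c_def add_pos_nonneg less_imp_le)
    qed
    finally have "B j ^ n * ?\<psi> (B j * x + b j)
        \<le> (\<Sum>i\<in>I. h j i * ?L (x + a i / A i)) - ?l (B j)" by simp
    then have "\<beta> j * B j * (B j ^ n * ?\<psi> (B j * x + b j))
        \<le> \<beta> j * B j * ((\<Sum>i\<in>I. h j i * ?L (x + a i / A i)) - ?l (B j))"
      using Bj by (intro mult_left_mono) auto
    then show ?thesis by (simp add: mult_ac)
  qed
  have swap: "(\<Sum>j\<in>J. \<beta> j * B j * (\<Sum>i\<in>I. h j i * ?L (x + a i / A i)))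
      = (\<Sum>i\<in>I. (\<Sum>j\<in>J. \<beta> j * B j * h j i) * ?L (x + a i / A i))"
    by (simp add: sum_distrib_left sum_distrib_right mult_ac sum.swap[of _ J I])
  have "(\<Sum>i\<in>I. (\<alpha> i * A i - (\<Sum>j\<in>J. \<beta> j * B j * h j i)) * ?L (x + a i / A i))
           - (if n = 0 then (\<Sum>i\<in>I. \<alpha> i * A i * ln (A i)) - (\<Sum>j\<in>J. \<beta> j * B j * ln (B j)) else 0)
      = (\<Sum>i\<in>I. \<alpha> i * A i * (?L (x + a i / A i) - ?l (A i)))
        - (\<Sum>j\<in>J. \<beta> j * B j * ((\<Sum>i\<in>I. h j i * ?L (x + a i / A i)) - ?l (B j)))"
    by (simp add: left_diff_distrib right_diff_distrib sum_subtractf swap)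
  also have "\<dots> \<le> (\<Sum>i\<in>I. \<alpha> i * A i ^ Suc n * ?\<psi> (A i * x + a i))
        - (\<Sum>j\<in>J. \<beta> j * B j ^ Suc n * ?\<psi> (B j * x + b j))"
    by (intro diff_mono sum_mono num den)
  also have "\<dots> = (- 1) ^ Suc n * ((\<Sum>i\<in>I. \<alpha> i * A i ^ Suc n * Polygamma n (A i * x + a i))
           - (\<Sum>j\<in>J. \<beta> j * B j ^ Suc n * Polygamma n (B j * x + b j)))"
    by (simp only: right_diff_distrib sum_distrib_left mult_ac)
  finally show ?thesis .
qed

section \<open>Complete monotonicity from a sequence of derivatives\<close>

lemma deriv_eqI_pos:
  fixes f g :: "real \<Rightarrow> real"
  assumes eq: "\<And>y. y > 0 \<Longrightarrow> f y = g y"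
    and g: "(g has_real_derivative D) (at x)" and "x > 0"
  shows "(f has_real_derivative D) (at x)"
  by (rule has_field_derivative_transform_within_open[OF g, of "{0<..}"]) (use assms in auto)

text \<open>
  Iterating \<open>deriv\<close> on $(0,\infty)$ stays within a given chain of derivatives \<open>F\<close>, because derivatives
  at \<open>x > 0\<close> see only values near \<open>x\<close>.
\<close>

lemma completely_monotonicI:
  fixes F :: "nat \<Rightarrow> real \<Rightarrow> real"
  assumes eq: "\<And>x. x > 0 \<Longrightarrow> f x = F 0 x"
    and deriv: "\<And>n x. x > 0 \<Longrightarrow> (F n has_real_derivative F (Suc n) x) (at x)"
    and sign: "\<And>n x. x > 0 \<Longrightarrow> (- 1) ^ n * F n x \<ge> 0"
  shows "completely_monotonic f"
proof -
  have iter: "(deriv ^^ n) f x = F n x" if "x > 0" for n x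
    using that
  proof (induction n arbitrary: x)
    case 0
    then show ?case by (simp add: eq)
  next
    case (Suc n)
    show ?case
      using deriv_eqI_pos[OF Suc.IH deriv[OF Suc.prems] Suc.prems]
      by (simp add: DERIV_imp_deriv)
  qed
  have "(deriv ^^ n) f differentiable (at x)" if "x > 0" for n x
    using deriv_eqI_pos[OF iter deriv[OF that] that] real_differentiable_def by blast
  moreover have "f x \<ge> 0" if "x > 0" for x
    using sign[OF that, of 0] eq[OF that] by simp
  ultimately show ?thesis
    using sign by (auto simp: completely_monotonic_def infinitely_differentiable_pos_def iter)
qed

section \<open>Ratios of products of gamma functions\<close>

lemma ln_prod_powr:
  fixes f c :: "'i \<Rightarrow> real"
  assumes "finite S" and "\<And>i. i \<in> S \<Longrightarrow> f i > 0"
  shows "ln (\<Prod>i\<in>S. f i powr c i) = (\<Sum>i\<in>S. c i * ln (f i))"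
proof -
  have "f i powr c i \<noteq> 0" if "i \<in> S" for i
    using assms(2)[OF that] by simp
  then have "ln (\<Prod>i\<in>S. f i powr c i) = (\<Sum>i\<in>S. ln (f i powr c i))"
    using assms by (intro ln_prod) auto
  also have "\<dots> = (\<Sum>i\<in>S. c i * ln (f i))"
    using assms by (intro sum.cong) (force simp: ln_powr)+
  finally show ?thesis .
qed

theorem corollary3p8:
  fixes p s :: nat
    and \<theta> :: real
    and A a \<alpha> B b \<beta> :: "nat \<Rightarrow> real"
    and h :: "nat \<Rightarrow> nat \<Rightarrow> real"
    and V :: "real \<Rightarrow> real"
  assumes theta: "\<theta> > 0"
    and A: "\<And>i. i \<in> {1..p} \<Longrightarrow> A i > 0 \<and> \<alpha> i > 0 \<and> a i \<ge> 0"
    and B: "\<And>j. j \<in> {1..s} \<Longrightarrow> B j > 0 \<and> \<beta> j > 0 \<and> b j \<ge> 0"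
    and V: "\<And>x. x > 0 \<Longrightarrow> V x = \<theta> powr (- x) *
              ((\<Prod>i=1..p. Gamma (A i * x + a i) powr \<alpha> i) /
               (\<Prod>j=1..s. Gamma (B j * x + b j) powr \<beta> j))"
    and h: "row_stochastic s p h"
    and colsum: "\<And>i. i \<in> {1..p} \<Longrightarrow> \<alpha> i * A i \<ge> (\<Sum>j=1..s. \<beta> j * B j * h j i)"
    and rowsum: "\<And>j. j \<in> {1..s} \<Longrightarrow> b j \<ge> B j * (\<Sum>i=1..p. a i / A i * h j i) + 1"
  shows "(twice_differentiable_pos (\<lambda>x. ln (V x)) \<and>
          completely_monotonic (deriv (deriv (\<lambda>x. ln (V x))))) \<and>
         ((\<Sum>i=1..p. \<alpha> i * A i) = (\<Sum>j=1..s. \<beta> j * B j) \<and>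
          (\<Prod>i=1..p. A i powr (\<alpha> i * A i)) * (\<Prod>j=1..s. B j powr (- (\<beta> j * B j))) \<le> \<theta>
          \<longrightarrow> log_completely_monotonic V)"
proof -
  \<comment> \<open>The \<open>n\<close>th derivative of $(\log V)'$; the factor \<open>\<theta> powr (- x)\<close> contributes only for \<open>n = 0\<close>.\<close>
  define F where "F n x = (if n = 0 then - ln \<theta> else 0)
      + ((\<Sum>i=1..p. \<alpha> i * A i ^ Suc n * Polygamma n (A i * x + a i))
       - (\<Sum>j=1..s. \<beta> j * B j ^ Suc n * Polygamma n (B j * x + b j)))" for n x
  have Apos: "A i * x + a i > 0" if "i \<in> {1..p}" "x > 0" for i x
    using A[OF that(1)] that(2) by (auto intro: add_pos_nonneg)
  have Bpos: "B j * x + b j > 0" if "j \<in> {1..s}" "x > 0" for j x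
    using B[OF that(1)] that(2) by (auto intro: add_pos_nonneg)
  have num: "Gamma (A i * x + a i) > 0" if "i \<in> {1..p}" "x > 0" for i x
    using Apos[OF that] by (rule Gamma_real_pos)
  have den: "Gamma (B j * x + b j) > 0" if "j \<in> {1..s}" "x > 0" for j x
    using Bpos[OF that] by (rule Gamma_real_pos)
  have V_pos: "V x > 0" if "x > 0" for x
    unfolding V[OF that] using theta num[OF _ that] den[OF _ that]
    by (intro mult_pos_pos divide_pos_pos prod_pos) force+
  have ln_V: "ln (V x) = - x * ln \<theta> + ((\<Sum>i=1..p. \<alpha> i * ln_Gamma (A i * x + a i))
      - (\<Sum>j=1..s. \<beta> j * ln_Gamma (B j * x + b j)))" if x: "x > 0" for x
  proof -
    note num = num[OF _ x] and den = den[OF _ x]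
    have P: "(\<Prod>i=1..p. Gamma (A i * x + a i) powr \<alpha> i) > 0"
      "(\<Prod>j=1..s. Gamma (B j * x + b j) powr \<beta> j) > 0"
      using num den by (force intro!: prod_pos)+
    have "ln (\<Prod>i=1..p. Gamma (A i * x + a i) powr \<alpha> i)
        = (\<Sum>i=1..p. \<alpha> i * ln_Gamma (A i * x + a i))"
      using num Apos[OF _ x] by (subst ln_prod_powr) (auto simp: ln_Gamma_real_pos)
    moreover have "ln (\<Prod>j=1..s. Gamma (B j * x + b j) powr \<beta> j)
        = (\<Sum>j=1..s. \<beta> j * ln_Gamma (B j * x + b j))"
      using den Bpos[OF _ x] by (subst ln_prod_powr) (auto simp: ln_Gamma_real_pos)
    moreover have "ln (\<theta> powr (- x) * (P / Q)) = - x * ln \<theta> + (ln P - ln Q)"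
      if "P > 0" "Q > 0" for P Q
      using theta that by (simp add: ln_mult ln_div ln_powr)
    ultimately show ?thesis
      using P by (simp only: V[OF x])
  qed
  have nonpole: "z \<notin> \<int>\<^sub>\<le>\<^sub>0" if "z > 0" for z :: real
    using that by (auto elim!: nonpos_Ints_cases)
  have deriv_ln_V: "((\<lambda>x. ln (V x)) has_real_derivative F 0 x) (at x)" if x: "x > 0" for x
    by (rule deriv_eqI_pos[OF ln_V _ x], assumption)
       (use x Apos[OF _ x] Bpos[OF _ x] in
         \<open>auto intro!: derivative_eq_intros simp: F_def mult_ac\<close>)
  have deriv_F: "(F n has_real_derivative F (Suc n) x) (at x)" if x: "x > 0" for n x
    unfolding F_def
    by (use x Apos[OF _ x] Bpos[OF _ x] in
         \<open>auto intro!: derivative_eq_intros nonpole simp: mult_ac\<close>)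
  have h_nonneg: "h j i \<ge> 0" if "j \<in> {1..s}" "i \<in> {1..p}" for i j
    using h that by (simp add: row_stochastic_def)
  have h_sum: "(\<Sum>i=1..p. h j i) = 1" if "j \<in> {1..s}" for j
    using h that by (simp add: row_stochastic_def)
  have bound: "(\<Sum>i=1..p. (\<alpha> i * A i - (\<Sum>j=1..s. \<beta> j * B j * h j i))
        * alt_ln_deriv n (x + a i / A i))
      - (if n = 0 then (\<Sum>i=1..p. \<alpha> i * A i * ln (A i)) - (\<Sum>j=1..s. \<beta> j * B j * ln (B j)) else 0)
      \<le> (- 1) ^ Suc n * ((\<Sum>i=1..p. \<alpha> i * A i ^ Suc n * Polygamma n (A i * x + a i))
          - (\<Sum>j=1..s. \<beta> j * B j ^ Suc n * Polygamma n (B j * x + b j)))"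
    if "x > 0" for n x
    using A B that
    by (intro alt_Polygamma_balance h_nonneg h_sum rowsum) (auto simp: less_imp_le)
  have sign_Suc: "(- 1) ^ n * F (Suc n) x \<ge> 0" if x: "x > 0" for n x
  proof -
    have "(\<alpha> i * A i - (\<Sum>j=1..s. \<beta> j * B j * h j i)) * alt_ln_deriv (Suc n) (x + a i / A i) \<ge> 0"
      if i: "i \<in> {1..p}" for i
      using colsum[OF i] A[OF i] x
      by (intro mult_nonneg_nonneg alt_ln_deriv_nonneg) (auto intro: add_pos_nonneg)
    then have "0 \<le> (\<Sum>i=1..p. (\<alpha> i * A i - (\<Sum>j=1..s. \<beta> j * B j * h j i))
        * alt_ln_deriv (Suc n) (x + a i / A i))"
      by (rule sum_nonneg)
    then show ?thesis
      using bound[OF x, of "Suc n"] by (simp add: F_def)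
  qed
  have deriv_eq: "deriv (\<lambda>x. ln (V x)) x = F 0 x" if "x > 0" for x
    using deriv_ln_V[OF that] by (rule DERIV_imp_deriv)
  have deriv2: "(deriv (\<lambda>x. ln (V x)) has_real_derivative F 1 x) (at x)" if "x > 0" for x
    using deriv_eqI_pos[OF deriv_eq deriv_F[OF that] that] by simp
  have "twice_differentiable_pos (\<lambda>x. ln (V x))"
    unfolding twice_differentiable_pos_def
    using deriv_ln_V deriv2 real_differentiable_def by blast
  moreover have "completely_monotonic (deriv (deriv (\<lambda>x. ln (V x))))"
    by (rule completely_monotonicI[where F = "\<lambda>n. F (Suc n)"])
       (use deriv2 deriv_F sign_Suc in \<open>auto intro: DERIV_imp_deriv\<close>)
  moreover have "log_completely_monotonic V"
    if total: "(\<Sum>i=1..p. \<alpha> i * A i) = (\<Sum>j=1..s. \<beta> j * B j)"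
      and prods: "(\<Prod>i=1..p. A i powr (\<alpha> i * A i)) * (\<Prod>j=1..s. B j powr (- (\<beta> j * B j))) \<le> \<theta>"
  proof -
    have "(\<Sum>i=1..p. \<Sum>j=1..s. \<beta> j * B j * h j i) = (\<Sum>j=1..s. \<beta> j * B j * (\<Sum>i=1..p. h j i))"
      by (subst sum.swap) (simp add: sum_distrib_left)
    also have "\<dots> = (\<Sum>i=1..p. \<alpha> i * A i)"
      using h_sum total by simp
    finally have "(\<Sum>i=1..p. \<alpha> i * A i - (\<Sum>j=1..s. \<beta> j * B j * h j i)) = 0"
      by (simp add: sum_subtractf)
    \<comment> \<open>Nonnegative column defects with total 0 vanish, which removes the unsigned logarithms for \<open>n = 0\<close>.\<close>
    then have tight: "\<alpha> i * A i - (\<Sum>j=1..s. \<beta> j * B j * h j i) = 0" if "i \<in> {1..p}" for i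
      using that colsum by (subst (asm) sum_nonneg_eq_0_iff) auto
    have PA: "(\<Prod>i=1..p. A i powr (\<alpha> i * A i)) > 0"
      and PB: "(\<Prod>j=1..s. B j powr (- (\<beta> j * B j))) > 0"
      using A B by (force intro!: prod_pos)+
    have "(\<Sum>i=1..p. \<alpha> i * A i * ln (A i)) - (\<Sum>j=1..s. \<beta> j * B j * ln (B j))
        = ln ((\<Prod>i=1..p. A i powr (\<alpha> i * A i)) * (\<Prod>j=1..s. B j powr (- (\<beta> j * B j))))"
    proof -
      have "ln (\<Prod>i=1..p. A i powr (\<alpha> i * A i)) = (\<Sum>i=1..p. \<alpha> i * A i * ln (A i))"
        using A by (intro ln_prod_powr) auto
      moreover have "ln (\<Prod>j=1..s. B j powr (- (\<beta> j * B j))) = (\<Sum>j=1..s. - (\<beta> j * B j) * ln (B j))"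
        using B by (intro ln_prod_powr) auto
      ultimately show ?thesis
        using ln_mult_pos[OF PA PB] by (simp only: sum_negf mult_minus_left)
    qed
    also have "\<dots> \<le> ln \<theta>"
      using prods PA PB theta by (simp add: mult_pos_pos)
    finally have ln_le: "(\<Sum>i=1..p. \<alpha> i * A i * ln (A i)) - (\<Sum>j=1..s. \<beta> j * B j * ln (B j)) \<le> ln \<theta>" .
    have sign_0: "F 0 x \<le> 0" if "x > 0" for x
      using bound[OF that, of 0] ln_le tight by (simp add: F_def)
    have sign: "(- 1) ^ n * - F n x \<ge> 0" if "x > 0" for n x
      using sign_0[OF that] sign_Suc[OF that] by (cases n) auto
    have "completely_monotonic (\<lambda>x. - deriv (\<lambda>y. ln (V y)) x)"
      by (rule completely_monotonicI[where F = "\<lambda>n x. - F n x"])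
         (use deriv_eq deriv_F sign in \<open>auto intro!: DERIV_minus\<close>)
    then show ?thesis
      unfolding log_completely_monotonic_def
      using V_pos deriv_ln_V real_differentiable_def by blast
  qed
  ultimately show ?thesis by blast
qed

end
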